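(* Let $n,m,L,\phi\in\mathbb{N}$ and consider the linear $\phi$-periodic system $x(k+1)=A(k)x(k)+B(k)u(k)$ with $A(k)\in\mathbb{R}^{n\times n}$, $B(k)\in\mathbb{R}^{n\times m}$, $A(k+\phi)=A(k)$, $B(k+\phi)=B(k)$ for all $k\ge0$. Let $X(k)\in\mathbb{R}^{n\times L}$, $k=0,\dots,\phi$, and $U(k)\in\mathbb{R}^{m\times L}$, $k=0,\dots,\phi-1$, be data matrices formed from input-state data of this system (see context), and suppose that $$\mathrm{rank}\begin{bmatrix}X(k)\\ U(k)\end{bmatrix}=n+m,\qquad k=0,\dots,\phi-1.$$ Let $\eta\ge1$ and $\rho>\eta$ be finite constants, and let $Y(k)\in\mathbb{R}^{L\times n}$, $k=0,\dots,\phi-1$, and $P(k)=P(k)^\top\in\mathbb{R}^{n\times n}$, $k=0,\dots,\phi$, be any matrix sequences satisfying $$\begin{bmatrix}P(k+1)-I_n & X(k+1)Y(k)\\ Y(k)^\top X(k+1)^\top & P(k)\end{bmatrix}\succeq 0,\qquad X(k)Y(k)=P(k),\qquad \eta I_n\preceq P(k)\preceq\rho I_n,$$ for $k=0,\dots,\phi-1$, and $$P(\phi)=P(0).$$ Then the closed-loop system $x(k+1)=\big(A(k)+B(k)K(k)\big)x(k)$, with $$K(k)=U(k)Y(k)P(k)^{-1},\quad k=0,\dots,\phi-1,\qquad K(k+n_p\phi)=K(k)\ \text{ for all integers } n_p\ge0,$$ is exponentially stable.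
   Context: $\succeq,\preceq$ refer to the semidefinite ordering of symmetric matrices. Data: the columns of $X(k)=[x_{d,1}(k),\dots,x_{d,L}(k)]$ and $U(k)=[u_{d,1}(k),\dots,u_{d,L}(k)]$ are recorded state and input samples of the system satisfying $x_{d,j}(k+1)=A(k)x_{d,j}(k)+B(k)u_{d,j}(k)$ for $j=1,\dots,L$, $k=0,\dots,\phi-1$; they stem either from an ensemble of $L$ experiments of length $\phi$ or from a single experiment of length $L\phi$ cut into $L$ consecutive periods. Hence $X(k+1)=A(k)X(k)+B(k)U(k)$ for $k=0,\dots,\phi-1$. *)

theory Defs
  imports "HOL-Analysis.Analysis"
begin

definition psd :: "real^'n^'n \<Rightarrow> bool" where
  "psd M \<longleftrightarrow> transpose M = M \<and> (\<forall>v. 0 \<le> v \<bullet> (M *v v))"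

text \<open>The semidefinite ordering; on symmetric matrices it is the usual Loewner order.\<close>

definition loewner_le :: "real^'n^'n \<Rightarrow> real^'n^'n \<Rightarrow> bool"  (infix "\<preceq>\<^sub>L" 50) where
  "M \<preceq>\<^sub>L N \<longleftrightarrow> psd (N - M)"

text \<open>Block matrices are indexed by sum types: \<open>Inl\<close> is the first (upper or left) block,
  \<open>Inr\<close> the second.\<close>

definition vstack :: "real^'l^'n \<Rightarrow> real^'l^'m \<Rightarrow> real^'l^('n + 'm)" where
  "vstack M N = (\<chi> i. case i of Inl a \<Rightarrow> M $ a | Inr b \<Rightarrow> N $ b)"

definition hstack :: "real^'p^'n \<Rightarrow> real^'q^'n \<Rightarrow> real^('p + 'q)^'n" where
  "hstack M N = (\<chi> i j. case j of Inl a \<Rightarrow> M $ i $ a | Inr b \<Rightarrow> N $ i $ b)"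

definition block_matrix ::
  "real^'p^'n \<Rightarrow> real^'q^'n \<Rightarrow> real^'p^'m \<Rightarrow> real^'q^'m \<Rightarrow> real^('p + 'q)^('n + 'm)" where
  "block_matrix M11 M12 M21 M22 = vstack (hstack M11 M12) (hstack M21 M22)"

text \<open>Exponential stability of the time-varying system \<open>x(k+1) = F(k) x(k)\<close>:
  the constants are uniform in the initial time and the initial state.\<close>

definition exponentially_stable :: "(nat \<Rightarrow> real^'n^'n) \<Rightarrow> bool" where
  "exponentially_stable F \<longleftrightarrow>
     (\<exists>c>0. \<exists>r. 0 < r \<and> r < 1 \<and>
        (\<forall>(x :: nat \<Rightarrow> real^'n) k0. (\<forall>k\<ge>k0. x (k + 1) = F k *v x k) \<longrightarrow>
           (\<forall>k\<ge>k0. norm (x k) \<le> c * r ^ (k - k0) * norm (x k0))))"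

end

theory Submission
  imports Defs
begin

text \<open>
  Put \<open>F k = A k + B k ** K k\<close>. Since \<open>K k ** P k = U k ** Y k\<close> and \<open>X k ** Y k = P k\<close>, the
  data equation gives \<open>X (k + 1) ** Y k = F k ** P k\<close>: the unknown closed loop can be read off
  from the data (\<open>data_closed_loop\<close>). The linear matrix inequality then becomes a Schur complement
  whose quadratic form at \<open>(w, - transpose (F k) *v w)\<close> says that
  \<open>F k ** P k ** transpose (F k)\<close> is at most \<open>P (k + 1) - mat 1\<close>
  (\<open>adjoint_decrease_of_block_psd\<close>).

  This is a Lyapunov inequality for the adjoint system, which runs backwards in time:
  \<open>V k w = w \<bullet> (P k *v w)\<close> shrinks by at least the factor \<open>1 - 1/\<rho>\<close> when \<open>w\<close> at time \<open>k + 1\<close> is replaced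
  by \<open>transpose (F k) *v w\<close> at time \<open>k\<close>, because \<open>P (k + 1)\<close> is at most \<open>\<rho>\<close> times the identity.
  As \<open>w \<bullet> x (k + 1) = (transpose (F k) *v w) \<bullet> x k\<close> along a trajectory, the functional
  \<open>w \<bullet> x k\<close> equals \<open>z \<bullet> x k0\<close> for a \<open>z\<close> that is exponentially small relative to \<open>w\<close>, and the
  choice \<open>w = x k\<close> bounds the state itself (\<open>exponentially_stable_of_adjoint_lyapunov\<close>). Working
  with the adjoint avoids inverting the Lyapunov matrices. Finally, \<open>P \<phi> = P 0\<close> allows the
  inequalities over one period to be continued periodically to all times.
\<close>

section \<open>Quadratic forms of block matrices\<close>

definition vec_pair :: "real^'n \<Rightarrow> real^'m \<Rightarrow> real^('n + 'm)" where
  "vec_pair v w = (\<chi> i. case i of Inl a \<Rightarrow> v $ a | Inr b \<Rightarrow> w $ b)"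

lemma sum_UNIV_Plus:
  fixes f :: "'a::finite + 'b::finite \<Rightarrow> real"
  shows "sum f UNIV = (\<Sum>a\<in>UNIV. f (Inl a)) + (\<Sum>b\<in>UNIV. f (Inr b))"
  using sum.Plus[of UNIV UNIV f] by (simp add: comp_def)

lemma inner_vec_pair: "vec_pair v w \<bullet> vec_pair v' w' = v \<bullet> v' + w \<bullet> w'"
  by (simp add: inner_vec_def vec_pair_def sum_UNIV_Plus)

lemma block_matrix_mult_vec_pair:
  "block_matrix M11 M12 M21 M22 *v vec_pair v w
    = vec_pair (M11 *v v + M12 *v w) (M21 *v v + M22 *v w)"
  by (simp add: vec_eq_iff block_matrix_def vstack_def hstack_def vec_pair_def
      matrix_vector_mult_def sum_UNIV_Plus split: sum.split)

text \<open>The test vector \<open>(w, - transpose F *v w)\<close> minimises the quadratic form over its second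
  component, so it extracts the Schur complement.\<close>

lemma adjoint_decrease_of_block_psd:
  fixes F P Q :: "real^'n^'n"
  assumes "psd (block_matrix (Q - mat 1) (F ** P) (transpose (F ** P)) P)"
  shows "(transpose F *v w) \<bullet> (P *v (transpose F *v w)) \<le> w \<bullet> (Q *v w) - w \<bullet> w"
proof -
  define z where "z = transpose F *v w"
  have cross: "w \<bullet> ((F ** P) *v z) = z \<bullet> (P *v z)"
    unfolding matrix_vector_mul_assoc[symmetric] dot_lmul_matrix[symmetric]
    by (simp add: z_def dot_lmul_matrix)
  have "0 \<le> vec_pair w (- z) \<bullet>
      (block_matrix (Q - mat 1) (F ** P) (transpose (F ** P)) P *v vec_pair w (- z))"
    using assms unfolding psd_def by blast
  also have "\<dots> = w \<bullet> ((Q - mat 1) *v w) + w \<bullet> ((F ** P) *v (- z))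
      + ((- z) \<bullet> (transpose (F ** P) *v w) + (- z) \<bullet> (P *v (- z)))"
    by (simp only: block_matrix_mult_vec_pair inner_vec_pair inner_add_right)
  also have "w \<bullet> ((F ** P) *v (- z)) = - (z \<bullet> (P *v z))"
    using cross by (simp add: linear_neg[OF matrix_vector_mul_linear])
  also have "(- z) \<bullet> (transpose (F ** P) *v w) = - (z \<bullet> (P *v z))"
    using cross by (simp add: inner_commute[of z] dot_lmul_matrix)
  also have "(- z) \<bullet> (P *v (- z)) = z \<bullet> (P *v z)"
    by (simp add: linear_neg[OF matrix_vector_mul_linear])
  finally show ?thesis
    by (simp add: z_def matrix_vector_mult_diff_rdistrib inner_diff_right)
qed

section \<open>Stability from an adjoint Lyapunov function\<close>

text \<open>The factor \<open>1 - 1/\<rho>\<close> comes from \<open>w \<bullet> w \<ge> (w \<bullet> (P (k + 1) *v w)) / \<rho>\<close>. In the induction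
  the functional is pulled back one step at a time, so no transition matrix is needed; the
  Cauchy-Schwarz inequality at \<open>w = x k\<close> replaces the equality of the norms of a matrix and its
  transpose.\<close>

lemma exponentially_stable_of_adjoint_lyapunov:
  fixes F P :: "nat \<Rightarrow> real^'n^'n"
  assumes "0 < \<eta>" and "1 < \<rho>"
    and lower: "\<And>k w. \<eta> * (w \<bullet> w) \<le> w \<bullet> (P k *v w)"
    and upper: "\<And>k w. w \<bullet> (P k *v w) \<le> \<rho> * (w \<bullet> w)"
    and decrease: "\<And>k w. (transpose (F k) *v w) \<bullet> (P k *v (transpose (F k) *v w))
                       \<le> w \<bullet> (P (k + 1) *v w) - w \<bullet> w"
  shows "exponentially_stable F"
proof -
  define q where "q = 1 - 1 / \<rho>"
  have q: "0 < q" "q < 1"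
    using \<open>1 < \<rho>\<close> by (auto simp: q_def field_simps)
  have contract: "(transpose (F k) *v w) \<bullet> (P k *v (transpose (F k) *v w))
      \<le> q * (w \<bullet> (P (k + 1) *v w))" for k w
  proof -
    have "w \<bullet> (P (k + 1) *v w) / \<rho> \<le> w \<bullet> w"
      using upper[of w "k + 1"] \<open>1 < \<rho>\<close> by (simp add: field_simps)
    then show ?thesis
      using decrease[of k w] by (simp add: q_def left_diff_distrib)
  qed
  have bound: "norm (x k) \<le> sqrt (\<rho> / \<eta>) * sqrt q ^ (k - k0) * norm (x k0)"
    if x: "\<forall>k\<ge>k0. x (k + 1) = F k *v x k" and "k0 \<le> k" for x :: "nat \<Rightarrow> real^'n" and k0 k
  proof -
    have pullback: "\<exists>z. w \<bullet> x (k0 + j) = z \<bullet> x k0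
        \<and> z \<bullet> (P k0 *v z) \<le> q ^ j * (w \<bullet> (P (k0 + j) *v w))" for j w
    proof (induction j arbitrary: w)
      case 0
      show ?case by (intro exI[of _ w]) simp
    next
      case (Suc j)
      define v where "v = transpose (F (k0 + j)) *v w"
      from Suc.IH[of v] obtain z where z: "v \<bullet> x (k0 + j) = z \<bullet> x k0"
        "z \<bullet> (P k0 *v z) \<le> q ^ j * (v \<bullet> (P (k0 + j) *v v))"
        by blast
      have "w \<bullet> x (k0 + Suc j) = v \<bullet> x (k0 + j)"
        using x by (simp add: v_def dot_lmul_matrix)
      moreover have "q ^ j * (v \<bullet> (P (k0 + j) *v v))
          \<le> q ^ j * (q * (w \<bullet> (P (k0 + Suc j) *v w)))"
        using contract[where k = "k0 + j" and w = w] q by (simp add: v_def)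
      ultimately show ?case
        using z by (intro exI[of _ z]) (simp add: algebra_simps)
    qed
    define y where "y = x k"
    obtain z where z: "y \<bullet> y = z \<bullet> x k0"
      "z \<bullet> (P k0 *v z) \<le> q ^ (k - k0) * (y \<bullet> (P k *v y))"
      using pullback[of y "k - k0"] \<open>k0 \<le> k\<close> by (auto simp: y_def)
    have "\<eta> * (norm z)\<^sup>2 \<le> q ^ (k - k0) * (y \<bullet> (P k *v y))"
      using z(2) lower[of z k0] by (simp add: power2_norm_eq_inner)
    also have "\<dots> \<le> q ^ (k - k0) * (\<rho> * (norm y)\<^sup>2)"
      using upper[of y k] q by (simp add: power2_norm_eq_inner)
    finally have "(norm z)\<^sup>2 \<le> \<rho> / \<eta> * q ^ (k - k0) * (norm y)\<^sup>2"
      using \<open>0 < \<eta>\<close> by (simp add: field_simps)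
    then have "norm z \<le> sqrt (\<rho> / \<eta> * q ^ (k - k0) * (norm y)\<^sup>2)"
      by (rule real_le_rsqrt)
    also have "\<dots> = sqrt (\<rho> / \<eta>) * sqrt q ^ (k - k0) * norm y"
      by (simp add: real_sqrt_mult real_sqrt_divide real_sqrt_power)
    finally have norm_z: "norm z \<le> sqrt (\<rho> / \<eta>) * sqrt q ^ (k - k0) * norm y" .
    have "norm y * norm y = z \<bullet> x k0"
      using z(1) by (simp add: power2_norm_eq_inner flip: power2_eq_square)
    also have "\<dots> \<le> norm z * norm (x k0)"
      by (rule norm_cauchy_schwarz)
    also have "\<dots> \<le> sqrt (\<rho> / \<eta>) * sqrt q ^ (k - k0) * norm y * norm (x k0)"
      by (rule mult_right_mono[OF norm_z]) simp
    finally have "norm y * norm y \<le> (sqrt (\<rho> / \<eta>) * sqrt q ^ (k - k0) * norm (x k0)) * norm y"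
      by (simp add: mult_ac)
    then show ?thesis
      using q \<open>0 < \<eta>\<close> \<open>1 < \<rho>\<close> unfolding y_def[symmetric]
      by (cases "norm y = 0") auto
  qed
  show ?thesis
    unfolding exponentially_stable_def
  proof (intro exI conjI allI impI)
    show "0 < sqrt (\<rho> / \<eta>)" using \<open>0 < \<eta>\<close> \<open>1 < \<rho>\<close> by simp
    show "0 < sqrt q" "sqrt q < 1" using q by auto
  qed (rule bound)
qed

section \<open>The closed loop in terms of the data\<close>

lemma scaleR_mat_1_loewner_leD:
  fixes M :: "real^'n^'n"
  assumes "c *\<^sub>R mat 1 \<preceq>\<^sub>L M"
  shows "c * (w \<bullet> w) \<le> w \<bullet> (M *v w)"
proof -
  have "0 \<le> w \<bullet> ((M - c *\<^sub>R mat 1) *v w)"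
    using assms unfolding loewner_le_def psd_def by blast
  then show ?thesis
    by (simp add: matrix_vector_mult_diff_rdistrib inner_diff_right scaleR_matrix_vector_assoc[symmetric])
qed

lemma loewner_le_scaleR_mat_1D:
  fixes M :: "real^'n^'n"
  assumes "M \<preceq>\<^sub>L c *\<^sub>R mat 1"
  shows "w \<bullet> (M *v w) \<le> c * (w \<bullet> w)"
proof -
  have "0 \<le> w \<bullet> ((c *\<^sub>R mat 1 - M) *v w)"
    using assms unfolding loewner_le_def psd_def by blast
  then show ?thesis
    by (simp add: matrix_vector_mult_diff_rdistrib inner_diff_right scaleR_matrix_vector_assoc[symmetric])
qed

lemma invertible_of_scaleR_mat_1_loewner_le:
  fixes M :: "real^'n^'n"
  assumes "0 < c" and "c *\<^sub>R mat 1 \<preceq>\<^sub>L M"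
  shows "invertible M"
proof -
  have "w = 0" if "M *v w = 0" for w
  proof -
    have "c * (w \<bullet> w) \<le> 0"
      using scaleR_mat_1_loewner_leD[OF assms(2), of w] that by simp
    then have "w \<bullet> w \<le> 0"
      using \<open>0 < c\<close> by (simp add: mult_le_0_iff)
    then show ?thesis
      using inner_gt_zero_iff[of w] by linarith
  qed
  then show ?thesis
    by (simp add: invertible_left_inverse matrix_left_invertible_ker)
qed

lemma matrix_mult_add_rdistrib:
  fixes A B :: "real^'n^'m"
  shows "(A + B) ** C = A ** C + B ** C"
  by (simp add: vec_eq_iff matrix_matrix_mult_def distrib_right sum.distrib)

lemma matrix_inv_left:
  fixes M :: "real^'n^'n"
  assumes "invertible M"
  shows "matrix_inv M ** M = mat 1"
  using someI_ex[OF assms[unfolded invertible_def]] unfolding matrix_inv_def by blast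

lemma matrix_eq_of_columns:
  assumes "\<And>j. column j X' = A *v column j X + B *v column j U"
  shows "X' = A ** X + B ** U"
  using assms
  by (simp add: vec_eq_iff column_def matrix_matrix_mult_def matrix_vector_mult_def)

text \<open>Multiplying the data equation by \<open>Y\<close> turns the recorded samples into the closed-loop matrix:
  \<open>A ** X ** Y\<close> is \<open>A ** P\<close>, and \<open>B ** U ** Y\<close> is \<open>B ** K ** P\<close> by the choice of the gain.\<close>

lemma data_closed_loop:
  fixes P :: "real^'n^'n"
  assumes "X' = A ** X + B ** U" and "X ** Y = P" and "invertible P"
  shows "X' ** Y = (A + B ** (U ** Y ** matrix_inv P)) ** P"
proof -
  have "(U ** Y ** matrix_inv P) ** P = U ** Y"
    using matrix_inv_left[OF assms(3)]
    by (simp add: matrix_mul_assoc[symmetric])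
  then show ?thesis
    unfolding assms(1)
    by (simp add: matrix_mult_add_rdistrib matrix_mul_assoc[symmetric] assms(2))
qed

lemma periodic_eq_mod:
  fixes f :: "nat \<Rightarrow> 'a"
  assumes "\<forall>k. f (k + p) = f k"
  shows "f k = f (k mod p)"
proof -
  have "f (i + n * p) = f i" for i n
  proof (induction n)
    case (Suc n)
    have "f (i + Suc n * p) = f ((i + n * p) + p)" by (simp add: algebra_simps)
    then show ?case using assms Suc by simp
  qed simp
  from this[of "k mod p" "k div p"] show ?thesis by simp
qed

theorem corollary1:
  fixes \<phi> :: nat
    and A :: "nat \<Rightarrow> real^'n^'n"
    and B :: "nat \<Rightarrow> real^'m^'n"
    and X :: "nat \<Rightarrow> real^'L^'n"
    and U :: "nat \<Rightarrow> real^'L^'m"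
    and Y :: "nat \<Rightarrow> real^'n^'L"
    and P :: "nat \<Rightarrow> real^'n^'n"
    and K :: "nat \<Rightarrow> real^'n^'m"
    and \<eta> \<rho> :: real
  assumes period_pos: "\<phi> \<ge> 1"
    and A_periodic: "\<forall>k. A (k + \<phi>) = A k"
    and B_periodic: "\<forall>k. B (k + \<phi>) = B k"
    and data: "\<forall>k<\<phi>. \<forall>j. column j (X (k + 1)) = A k *v column j (X k) + B k *v column j (U k)"
    and rank_cond: "\<forall>k<\<phi>. rank (vstack (X k) (U k)) = CARD('n) + CARD('m)"
    and eta: "\<eta> \<ge> 1"
    and rho: "\<rho> > \<eta>"
    and P_sym: "\<forall>k\<le>\<phi>. P k = transpose (P k)"
    and lmi: "\<forall>k<\<phi>. 0 \<preceq>\<^sub>L block_matrix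
                 (P (k + 1) - mat 1)                       (X (k + 1) ** Y k)
                 (transpose (Y k) ** transpose (X (k + 1)))  (P k)"
    and XY: "\<forall>k<\<phi>. X k ** Y k = P k"
    and P_bounds: "\<forall>k<\<phi>. \<eta> *\<^sub>R mat 1 \<preceq>\<^sub>L P k \<and> P k \<preceq>\<^sub>L \<rho> *\<^sub>R mat 1"
    and P_periodic: "P \<phi> = P 0"
    and K_def: "\<forall>k<\<phi>. K k = U k ** Y k ** matrix_inv (P k)"
    and K_periodic: "\<forall>k<\<phi>. \<forall>n\<^sub>p. K (k + n\<^sub>p * \<phi>) = K k"
  shows "exponentially_stable (\<lambda>k. A k + B k ** K k)"
proof -
  define F where "F k = A k + B k ** K k" for k
  \<comment> \<open>Only \<open>P 0, \<dots>, P \<phi>\<close> are constrained, so the Lyapunov matrices are the periodic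
    continuation of \<open>P\<close>.\<close>
  define Q where "Q k = P (k mod \<phi>)" for k
  have mod_less: "k mod \<phi> < \<phi>" for k
    using period_pos by simp
  have F_mod: "F k = F (k mod \<phi>)" for k
  proof -
    have "K (k mod \<phi> + (k div \<phi>) * \<phi>) = K (k mod \<phi>)"
      using K_periodic mod_less by blast
    then have "K k = K (k mod \<phi>)" by simp
    then show ?thesis
      unfolding F_def
      using periodic_eq_mod[OF A_periodic, of k] periodic_eq_mod[OF B_periodic, of k] by simp
  qed
  have Q_Suc: "Q (k + 1) = P (k mod \<phi> + 1)" for k
    using P_periodic by (simp add: Q_def mod_Suc)
  have decrease: "(transpose (F k) *v w) \<bullet> (P k *v (transpose (F k) *v w))
      \<le> w \<bullet> (P (k + 1) *v w) - w \<bullet> w" if "k < \<phi>" for k w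
  proof -
    have "\<eta> *\<^sub>R mat 1 \<preceq>\<^sub>L P k" using P_bounds that by blast
    then have inv: "invertible (P k)"
      using eta by (intro invertible_of_scaleR_mat_1_loewner_le[of \<eta>]) auto
    have "X (k + 1) = A k ** X k + B k ** U k"
      using data that by (intro matrix_eq_of_columns) blast
    moreover have "X k ** Y k = P k" using XY that by blast
    ultimately have "X (k + 1) ** Y k = (A k + B k ** (U k ** Y k ** matrix_inv (P k))) ** P k"
      using inv by (rule data_closed_loop)
    then have "X (k + 1) ** Y k = F k ** P k"
      using K_def that by (simp add: F_def)
    moreover have "psd (block_matrix (P (k + 1) - mat 1) (X (k + 1) ** Y k)
        (transpose (X (k + 1) ** Y k)) (P k))"
      using lmi that by (simp add: loewner_le_def matrix_transpose_mul)
    ultimately have "psd (block_matrix (P (k + 1) - mat 1) (F k ** P k) (transpose (F k ** P k)) (P k))"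
      by simp
    then show ?thesis by (rule adjoint_decrease_of_block_psd)
  qed
  have "exponentially_stable F"
  proof (rule exponentially_stable_of_adjoint_lyapunov)
    show "0 < \<eta>" "1 < \<rho>" using eta rho by auto
    fix k and w :: "real^'n"
    show "\<eta> * (w \<bullet> w) \<le> w \<bullet> (Q k *v w)"
      using P_bounds mod_less scaleR_mat_1_loewner_leD unfolding Q_def by blast
    show "w \<bullet> (Q k *v w) \<le> \<rho> * (w \<bullet> w)"
      using P_bounds mod_less loewner_le_scaleR_mat_1D unfolding Q_def by blast
    show "(transpose (F k) *v w) \<bullet> (Q k *v (transpose (F k) *v w))
        \<le> w \<bullet> (Q (k + 1) *v w) - w \<bullet> w"
      using decrease[OF mod_less[of k], of w] unfolding Q_Suc F_mod[of k]
      unfolding Q_def .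
  qed
  then show ?thesis unfolding F_def .
qed

end
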